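(* Let $n$ be a positive integer and let $b=\lfloor\log_2 n\rfloor+2$. Then evaluating the expansion of $(1+x_1)^n\in\mathcal{K}_b$ at $x_1=x_2=\cdots=x_b=1$ yields $\binom{2n}{n}$.
   Context: For a positive integer $N$, let $\mathcal{K}_N=\mathbb{Z}[x_1,\ldots,x_N]/I$ with $I=\langle x_1^2-P_1,\ldots,x_N^2-P_N\rangle$, where $P_i=2x_i+x_{i+1}$ for $1\le i<N$ and $P_N=0$. Thus $x_i^2=2x_i+x_{i+1}$ for $1\le i<N$ and $x_N^2=0$ in $\mathcal{K}_N$. The expansion of an element of $\mathcal{K}_N$ is its fully reduced representative: the unique polynomial in $\mathbb{Z}[x_1,\ldots,x_N]$ of degree at most $1$ in each variable $x_i$ that represents it modulo $I$. Evaluating the expansion at $x_1=\cdots=x_N=1$ means summing the coefficients of this representative. *)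

theory Defs
  imports Complex_Main "HOL-Library.Poly_Mapping" "HOL-Algebra.QuotRing"
begin

text \<open>
  Polynomials over the integers in the variables \<open>x\<^sub>0, x\<^sub>1, \<dots>\<close>: a monomial maps each variable index
  to its exponent, a polynomial maps each monomial to its coefficient. Addition and
  multiplication are those of the type class instances in \<^theory>\<open>HOL-Library.Poly_Mapping\<close>;
  the product is the convolution product.
\<close>

type_synonym int_mpoly = "(nat \<Rightarrow>\<^sub>0 nat) \<Rightarrow>\<^sub>0 int"

definition Var :: "nat \<Rightarrow> int_mpoly" where
  "Var i = Poly_Mapping.single (Poly_Mapping.single i 1) 1"

definition poly_ring :: "nat \<Rightarrow> int_mpoly ring" where
  "poly_ring N =
    \<lparr>carrier = {p. \<forall>m \<in> Poly_Mapping.keys p. Poly_Mapping.keys m \<subseteq> {1..N}},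
     mult = (*), one = 1, zero = 0, add = (+)\<rparr>"

definition Prel :: "nat \<Rightarrow> nat \<Rightarrow> int_mpoly" where
  "Prel N i = (if i < N then 2 * Var i + Var (i + 1) else 0)"

definition rel_ideal :: "nat \<Rightarrow> int_mpoly set" where
  "rel_ideal N = Idl\<^bsub>poly_ring N\<^esub> ((\<lambda>i. Var i ^ 2 - Prel N i) ` {1..N})"

definition KN :: "nat \<Rightarrow> int_mpoly set ring" where
  "KN N = poly_ring N Quot rel_ideal N"

definition gen :: "nat \<Rightarrow> nat \<Rightarrow> int_mpoly set" where
  "gen N i = rel_ideal N +>\<^bsub>poly_ring N\<^esub> Var i"

definition reduced :: "int_mpoly \<Rightarrow> bool" where
  "reduced p \<longleftrightarrow> (\<forall>m \<in> Poly_Mapping.keys p. \<forall>i. Poly_Mapping.lookup m i \<le> 1)"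

text \<open>Elements of \<open>KN N\<close> are cosets, so a polynomial represents \<open>u\<close> iff it belongs to \<open>u\<close>.\<close>

definition expansion :: "nat \<Rightarrow> int_mpoly set \<Rightarrow> int_mpoly" where
  "expansion N u = (THE p. p \<in> carrier (poly_ring N) \<and> reduced p \<and> p \<in> u)"

definition mpoly_eval :: "(nat \<Rightarrow> int) \<Rightarrow> int_mpoly \<Rightarrow> int" where
  "mpoly_eval a p =
    (\<Sum>m \<in> Poly_Mapping.keys p. Poly_Mapping.lookup p m *
      (\<Prod>i \<in> Poly_Mapping.keys m. a i ^ Poly_Mapping.lookup m i))"

lemma cring_poly_ring: "cring (poly_ring N)"
proof -
  let ?C = "{p :: int_mpoly. \<forall>m \<in> Poly_Mapping.keys p. Poly_Mapping.keys m \<subseteq> {1..N}}"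
  have add: "p + q \<in> ?C" if "p \<in> ?C" "q \<in> ?C" for p q
    using that keys_add[of p q] by blast
  have mult: "p * q \<in> ?C" if p: "p \<in> ?C" and q: "q \<in> ?C" for p q
  proof (intro CollectI ballI)
    fix m assume "m \<in> Poly_Mapping.keys (p * q)"
    then obtain a b where "m = a + b" "a \<in> Poly_Mapping.keys p" "b \<in> Poly_Mapping.keys q"
      using keys_mult[of p q] by blast
    then show "Poly_Mapping.keys m \<subseteq> {1..N}"
      using p q keys_add[of a b] by blast
  qed
  have zero_poly: "0 \<in> ?C" and one_poly: "1 \<in> ?C"
    by simp_all
  show ?thesis
  proof (intro cringI abelian_groupI comm_monoidI)
    fix x assume "x \<in> carrier (poly_ring N)"
    then have "- x \<in> carrier (poly_ring N)" "- x \<oplus>\<^bsub>poly_ring N\<^esub> x = \<zero>\<^bsub>poly_ring N\<^esub>"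
      by (simp_all add: poly_ring_def)
    then show "\<exists>y\<in>carrier (poly_ring N). y \<oplus>\<^bsub>poly_ring N\<^esub> x = \<zero>\<^bsub>poly_ring N\<^esub>"
      by (rule bexI[rotated])
  qed (simp_all only: poly_ring_def add mult partial_object.simps monoid.simps ring.simps
      zero_poly one_poly ac_simps mult_1_left mult_1_right add_0_left add_0_right
      distrib_left distrib_right)
qed

end

theory Submission
  imports Defs "HOL-Library.Nat_Bijection" "HOL-Computational_Algebra.Formal_Laurent_Series"
begin

text \<open>
  Writing \<open>x\<^sub>i = 1 + u\<^sub>i\<close>, the relation \<open>x\<^sub>i\<^sup>2 = 2 x\<^sub>i + x\<^bsub>i+1\<^esub>\<close> becomes the doubling rule
  \<open>u\<^bsub>i+1\<^esub> = u\<^sub>i\<^sup>2 - 2\<close>, which \<open>u\<^sub>i = z\<^sup>d + z\<^sup>-\<^sup>d\<close> satisfies when \<open>d\<close> doubles with each step. So the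
  Laurent polynomials \<open>t\<^sub>i = 1 + z\<^sup>d + z\<^sup>-\<^sup>d\<close> with \<open>d = 2\<^sup>i\<close> are a model of all relations of
  \<open>\<K>\<^sub>N\<close> except the top one, \<open>x\<^sub>N\<^sup>2 = 0\<close>.

  In this model the constant term computes the value at \<open>x\<^sub>1 = \<dots> = x\<^sub>N = 1\<close> of a reduced
  polynomial: a signed sum of distinct powers of \<open>2\<close> vanishes only if it is empty, so each
  product of distinct \<open>t\<^sub>i\<close> has constant term \<open>1\<close> (\<open>trinomial_prod_nth\<close>). On the other hand,
  \<open>1 + t\<^sub>1 = z\<^sup>-\<^sup>2 (1 + z\<^sup>2)\<^sup>2\<close>, so the constant term of \<open>(1 + t\<^sub>1)\<^sup>n\<close> is the middle coefficient
  of \<open>(1 + z\<^sup>2)\<^sup>2\<^sup>n\<close>, the central binomial coefficient (\<open>one_plus_trinomial_power_nth\<close>).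

  To combine both facts, \<open>(1 + x\<^sub>1)\<^sup>n\<close> has to be brought into reduced form without the top
  relation, which the model violates. Give \<open>x\<^sub>i\<close> the weight \<open>2\<^sup>i\<close>. The remaining relations do not
  raise the weight, reduced monomials correspond to the binary expansions of their weights, and
  a square of \<open>x\<^sub>N\<close> can only arise at weight \<open>2\<^bsup>N+1\<^esup>\<close> or more. As \<open>(1 + x\<^sub>1)\<^sup>n\<close> has weight
  \<open>2 n\<close>, the condition \<open>n < 2\<^sup>N\<close> suffices (\<open>reduces_below_power\<close>), and it holds for
  \<open>N = \<lfloor>log\<^sub>2 n\<rfloor> + 2\<close>.

  That the reduced form is the expansion rests on the uniqueness of reduced representatives
  (\<open>reduced_in_rel_ideal_eq_0\<close>). It is seen in \<open>\<int>[x]\<close>, where the variables are realised by iterating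
  \<open>p \<mapsto> p\<^sup>2 - 2 p\<close>: reduced monomials become monic polynomials of distinct degrees below
  \<open>2\<^bsup>N+1\<^esup>\<close>, while the ideal is mapped into the multiples of a polynomial of degree \<open>2\<^bsup>N+1\<^esup>\<close>.
\<close>

section \<open>Evaluation of polynomials in commutative rings\<close>

definition monom_eval :: "(nat \<Rightarrow> 'a::comm_ring_1) \<Rightarrow> (nat \<Rightarrow>\<^sub>0 nat) \<Rightarrow> 'a" where
  "monom_eval a m = (\<Prod>i\<in>Poly_Mapping.keys m. a i ^ Poly_Mapping.lookup m i)"

definition ring_eval :: "(nat \<Rightarrow> 'a::comm_ring_1) \<Rightarrow> int_mpoly \<Rightarrow> 'a" where
  "ring_eval a p =
    (\<Sum>m\<in>Poly_Mapping.keys p. of_int (Poly_Mapping.lookup p m) * monom_eval a m)"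

lemma monom_eval_superset:
  assumes "finite S" "Poly_Mapping.keys m \<subseteq> S"
  shows "monom_eval a m = (\<Prod>i\<in>S. a i ^ Poly_Mapping.lookup m i)"
  unfolding monom_eval_def using assms
  by (intro prod.mono_neutral_left) (auto simp: in_keys_iff)

lemma monom_eval_add: "monom_eval a (m + n) = monom_eval a m * monom_eval a n"
proof -
  let ?S = "Poly_Mapping.keys m \<union> Poly_Mapping.keys n"
  have "Poly_Mapping.keys (m + n) \<subseteq> ?S"
    by (rule keys_add)
  then show ?thesis
    by (simp add: monom_eval_superset[where S = ?S] lookup_add power_add prod.distrib)
qed

lemma ring_eval_superset:
  assumes "finite S" "Poly_Mapping.keys p \<subseteq> S"
  shows "ring_eval a p = (\<Sum>m\<in>S. of_int (Poly_Mapping.lookup p m) * monom_eval a m)"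
  unfolding ring_eval_def using assms
  by (intro sum.mono_neutral_left) (auto simp: in_keys_iff)

lemma ring_eval_0 [simp]: "ring_eval a 0 = 0"
  by (simp add: ring_eval_def)

lemma ring_eval_add: "ring_eval a (p + q) = ring_eval a p + ring_eval a q"
proof -
  let ?S = "Poly_Mapping.keys p \<union> Poly_Mapping.keys q"
  have "Poly_Mapping.keys (p + q) \<subseteq> ?S"
    by (rule keys_add)
  then show ?thesis
    by (simp add: ring_eval_superset[where S = ?S] lookup_add distrib_right sum.distrib)
qed

lemma ring_eval_sum: "ring_eval a (\<Sum>i\<in>I. f i) = (\<Sum>i\<in>I. ring_eval a (f i))"
  by (induction I rule: infinite_finite_induct) (simp_all add: ring_eval_add)

lemma ring_eval_single:
  "ring_eval a (Poly_Mapping.single m c) = of_int c * monom_eval a m"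
  by (simp add: ring_eval_def)

lemma ring_eval_Var [simp]: "ring_eval a (Var i) = a i"
  by (simp add: Var_def ring_eval_single monom_eval_def)

lemma ring_eval_1 [simp]: "ring_eval a 1 = 1"
  using ring_eval_single[of a 0 1] by (simp add: monom_eval_def)

lemma sum_of_terms:
  "p = (\<Sum>m\<in>Poly_Mapping.keys p. Poly_Mapping.single m (Poly_Mapping.lookup p m))"
  by (rule poly_mapping_eqI)
     (auto simp: lookup_sum lookup_single when_def in_keys_iff)

lemma ring_eval_mult: "ring_eval a (p * q) = ring_eval a p * ring_eval a q"
proof -
  have "p * q = (\<Sum>m\<in>Poly_Mapping.keys p. \<Sum>n\<in>Poly_Mapping.keys q.
      Poly_Mapping.single (m + n) (Poly_Mapping.lookup p m * Poly_Mapping.lookup q n))"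
    by (subst sum_of_terms[of p], subst sum_of_terms[of q])
       (simp add: sum_product mult_single)
  then have "ring_eval a (p * q) = (\<Sum>m\<in>Poly_Mapping.keys p. \<Sum>n\<in>Poly_Mapping.keys q.
      (of_int (Poly_Mapping.lookup p m) * monom_eval a m) *
      (of_int (Poly_Mapping.lookup q n) * monom_eval a n))"
    by (simp add: ring_eval_sum ring_eval_single monom_eval_add mult_ac)
  then show ?thesis
    by (simp add: ring_eval_def sum_product)
qed

lemma ring_eval_power: "ring_eval a (p ^ n) = ring_eval a p ^ n"
  by (induction n) (simp_all add: ring_eval_mult)

lemma ring_eval_uminus: "ring_eval a (- p) = - ring_eval a p"
  using ring_eval_add[of a p "- p"] by (simp add: eq_neg_iff_add_eq_0 add.commute)

lemma ring_eval_diff: "ring_eval a (p - q) = ring_eval a p - ring_eval a q"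
  using ring_eval_add[of a p "- q"] by (simp add: ring_eval_uminus)


section \<open>The polynomial ring and its ideals\<close>

lemma poly_ring_simps [simp]:
  "p \<otimes>\<^bsub>poly_ring N\<^esub> q = p * q" "p \<oplus>\<^bsub>poly_ring N\<^esub> q = p + q"
  "\<one>\<^bsub>poly_ring N\<^esub> = 1" "\<zero>\<^bsub>poly_ring N\<^esub> = 0"
  by (simp_all add: poly_ring_def)

lemma in_poly_ring_iff:
  "p \<in> carrier (poly_ring N) \<longleftrightarrow> (\<forall>m\<in>Poly_Mapping.keys p. Poly_Mapping.keys m \<subseteq> {1..N})"
  by (simp add: poly_ring_def)

lemma ring_poly_ring: "ring (poly_ring N)"
  using cring_poly_ring by (rule cring.axioms)

lemma poly_ring_closed [intro]:
  "0 \<in> carrier (poly_ring N)"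
  "1 \<in> carrier (poly_ring N)"
  "p \<in> carrier (poly_ring N) \<Longrightarrow> - p \<in> carrier (poly_ring N)"
  "\<lbrakk>p \<in> carrier (poly_ring N); q \<in> carrier (poly_ring N)\<rbrakk> \<Longrightarrow> p + q \<in> carrier (poly_ring N)"
  "\<lbrakk>p \<in> carrier (poly_ring N); q \<in> carrier (poly_ring N)\<rbrakk> \<Longrightarrow> p * q \<in> carrier (poly_ring N)"
proof -
  interpret ring "poly_ring N" by (rule ring_poly_ring)
  show "0 \<in> carrier (poly_ring N)" "1 \<in> carrier (poly_ring N)"
    using zero_closed one_closed by simp_all
  show "p \<in> carrier (poly_ring N) \<Longrightarrow> - p \<in> carrier (poly_ring N)"
    by (simp add: in_poly_ring_iff)
  show "\<lbrakk>p \<in> carrier (poly_ring N); q \<in> carrier (poly_ring N)\<rbrakk> \<Longrightarrow> p + q \<in> carrier (poly_ring N)"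
    using a_closed[of p q] by simp
  show "\<lbrakk>p \<in> carrier (poly_ring N); q \<in> carrier (poly_ring N)\<rbrakk> \<Longrightarrow> p * q \<in> carrier (poly_ring N)"
    using m_closed[of p q] by simp
qed

lemma poly_ring_diff_closed [intro]:
  "\<lbrakk>p \<in> carrier (poly_ring N); q \<in> carrier (poly_ring N)\<rbrakk> \<Longrightarrow> p - q \<in> carrier (poly_ring N)"
  using poly_ring_closed(4)[of p N "- q"] poly_ring_closed(3)[of q N] by simp

lemma poly_ring_power_closed [intro]:
  "p \<in> carrier (poly_ring N) \<Longrightarrow> p ^ n \<in> carrier (poly_ring N)"
  by (induction n) auto

lemma poly_ring_nat_pow: "p [^]\<^bsub>poly_ring N\<^esub> (n::nat) = p ^ n"
proof -
  interpret ring "poly_ring N" by (rule ring_poly_ring)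
  show ?thesis
    by (induction n) (simp_all add: mult.commute)
qed

lemma Var_closed [intro]: "i \<in> {1..N} \<Longrightarrow> Var i \<in> carrier (poly_ring N)"
  by (simp add: in_poly_ring_iff Var_def)

lemma ideal_poly_ring_closed:
  assumes "ideal I (poly_ring N)"
  shows "0 \<in> I"
    and "p \<in> I \<Longrightarrow> q \<in> I \<Longrightarrow> p + q \<in> I"
    and "p \<in> I \<Longrightarrow> r \<in> carrier (poly_ring N) \<Longrightarrow> r * p \<in> I"
    and "p \<in> I \<Longrightarrow> q \<in> I \<Longrightarrow> p - q \<in> I"
proof -
  interpret ideal I "poly_ring N" by (rule assms)
  show "0 \<in> I" using additive_subgroup.zero_closed[OF is_additive_subgroup] by simp
  show add: "p \<in> I \<Longrightarrow> q \<in> I \<Longrightarrow> p + q \<in> I" for p q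
    using additive_subgroup.a_closed[OF is_additive_subgroup, of p q] by simp
  show mult: "p \<in> I \<Longrightarrow> r \<in> carrier (poly_ring N) \<Longrightarrow> r * p \<in> I" for p r
    using I_l_closed[of p r] by simp
  have "q \<in> I \<Longrightarrow> - q \<in> I"
    using mult[of q "- 1"] poly_ring_closed by simp
  then show "p \<in> I \<Longrightarrow> q \<in> I \<Longrightarrow> p - q \<in> I"
    using add[of p "- q"] by simp
qed

text \<open>
  Both models are used through this lemma: the polynomials whose values are divisible by \<open>d\<close> form
  an ideal. For \<open>d = 0\<close> it says that an evaluation killing the generators kills the ideal.
\<close>

lemma dvd_ring_eval_genideal:
  assumes "G \<subseteq> carrier (poly_ring N)"
    and G: "\<And>g. g \<in> G \<Longrightarrow> d dvd ring_eval a g"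
    and "p \<in> Idl\<^bsub>poly_ring N\<^esub> G"
  shows "d dvd ring_eval a p"
proof -
  interpret ring "poly_ring N" by (rule ring_poly_ring)
  let ?I = "{p \<in> carrier (poly_ring N). d dvd ring_eval a p}"
  have neg: "\<ominus>\<^bsub>poly_ring N\<^esub> p = - p" if "p \<in> carrier (poly_ring N)" for p
    by (rule minus_equality) (use that in auto)
  have "ideal ?I (poly_ring N)"
  proof (rule idealI)
    show "ring (poly_ring N)" by (rule ring_poly_ring)
    show "subgroup ?I (add_monoid (poly_ring N))"
      by (rule add.subgroupI)
         (auto simp: a_inv_def[symmetric] neg ring_eval_add ring_eval_uminus intro!: exI[of _ 0])
  qed (auto simp: ring_eval_mult)
  then have "Idl\<^bsub>poly_ring N\<^esub> G \<subseteq> ?I"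
    by (rule genideal_minimal) (use assms in auto)
  then show ?thesis
    using assms(3) by auto
qed

text \<open>
  The ideal of the relations that hold in the Laurent model, that is, all except \<open>x\<^sub>N\<^sup>2 = 0\<close>.
\<close>

definition lower_ideal :: "nat \<Rightarrow> int_mpoly set" where
  "lower_ideal N = Idl\<^bsub>poly_ring N\<^esub> ((\<lambda>i. Var i ^ 2 - Prel N i) ` {1..<N})"

lemma generators_closed: "(\<lambda>i. Var i ^ 2 - Prel N i) ` {1..N} \<subseteq> carrier (poly_ring N)"
proof -
  have "Var i ^ 2 - Prel N i \<in> carrier (poly_ring N)" if "i \<in> {1..N}" for i
  proof -
    have "Var i \<in> carrier (poly_ring N)"
      using that by (rule Var_closed)
    moreover have "Var (i + 1) \<in> carrier (poly_ring N)" if "i < N"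
      using that by (intro Var_closed) auto
    ultimately show ?thesis
      unfolding Prel_def mult_2
      by (cases "i < N") (simp_all only: if_True if_False poly_ring_closed
          poly_ring_diff_closed poly_ring_power_closed)
  qed
  then show ?thesis by blast
qed

lemma ideal_rel_ideal: "ideal (rel_ideal N) (poly_ring N)"
  unfolding rel_ideal_def
  by (intro ring.genideal_ideal ring_poly_ring generators_closed)

lemma ideal_lower_ideal: "ideal (lower_ideal N) (poly_ring N)"
  unfolding lower_ideal_def
  by (intro ring.genideal_ideal ring_poly_ring order_trans[OF _ generators_closed]) auto

lemma ring_eval_lower_relation:
  assumes "i < N"
  shows "ring_eval a (Var i ^ 2 - Prel N i) = a i ^ 2 - (2 * a i + a (i + 1))"
proof -
  have "ring_eval a 2 = 2"
    unfolding one_add_one[symmetric] ring_eval_add ring_eval_1 ..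
  then show ?thesis
    using assms by (simp only: Prel_def if_True ring_eval_diff ring_eval_add ring_eval_mult
        ring_eval_power ring_eval_Var)
qed

lemma lower_ideal_subset: "lower_ideal N \<subseteq> rel_ideal N"
  unfolding lower_ideal_def
proof (rule ring.genideal_minimal[OF ring_poly_ring ideal_rel_ideal])
  show "(\<lambda>i. Var i ^ 2 - Prel N i) ` {1..<N} \<subseteq> rel_ideal N"
    using ring.genideal_self[OF ring_poly_ring generators_closed]
    unfolding rel_ideal_def by fastforce
qed

lemma lower_relation:
  assumes "i \<in> {1..<N}"
  shows "Var i ^ 2 - (2 * Var i + Var (i + 1)) \<in> lower_ideal N"
proof -
  have "(\<lambda>i. Var i ^ 2 - Prel N i) ` {1..<N} \<subseteq> lower_ideal N"
    unfolding lower_ideal_def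
    by (intro ring.genideal_self ring_poly_ring order_trans[OF _ generators_closed]) auto
  then have "Var i ^ 2 - Prel N i \<in> lower_ideal N"
    using assms by blast
  then show ?thesis
    using assms by (simp add: Prel_def)
qed

lemma mem_rcoset_iff: "p \<in> I +>\<^bsub>poly_ring N\<^esub> q \<longleftrightarrow> p - q \<in> I"
  by (auto simp: a_r_coset_def r_coset_def) (metis diff_add_cancel)


section \<open>Reduced polynomials\<close>

definition sqfree :: "nat set \<Rightarrow> int_mpoly" where
  "sqfree S = (\<Prod>i\<in>S. Var i)"

definition set_monom :: "nat set \<Rightarrow> (nat \<Rightarrow>\<^sub>0 nat)" where
  "set_monom S = (\<Sum>i\<in>S. Poly_Mapping.single i 1)"

lemma lookup_set_monom: "finite S \<Longrightarrow> Poly_Mapping.lookup (set_monom S) i = (if i \<in> S then 1 else 0)"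
  by (simp add: set_monom_def lookup_sum lookup_single when_def)

lemma keys_set_monom: "finite S \<Longrightarrow> Poly_Mapping.keys (set_monom S) = S"
  by (auto simp: in_keys_iff lookup_set_monom split: if_splits)

lemma sqfree_eq_single: "finite S \<Longrightarrow> sqfree S = Poly_Mapping.single (set_monom S) 1"
  by (induction S rule: finite_induct)
     (simp_all add: sqfree_def set_monom_def Var_def mult_single)

text \<open>
  Reduced monomials are thus in bijection with finite sets of variable indices, and by
  \<^const>\<open>set_encode\<close> with natural numbers. The code of \<open>S\<close> is the weight of its monomial when \<open>x\<^sub>i\<close>
  has weight \<open>2\<^sup>i\<close>.
\<close>

lemma reduced_monom_eq_set_monom:
  assumes "reduced p" "m \<in> Poly_Mapping.keys p"
  shows "m = set_monom (Poly_Mapping.keys m)"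
proof (rule poly_mapping_eqI)
  fix i
  have "Poly_Mapping.lookup m i \<le> 1"
    using assms by (auto simp: reduced_def)
  then show "Poly_Mapping.lookup m i = Poly_Mapping.lookup (set_monom (Poly_Mapping.keys m)) i"
    by (cases "Poly_Mapping.lookup m i") (auto simp: lookup_set_monom in_keys_iff)
qed

lemma reduced_monom_eval:
  assumes "reduced p" "m \<in> Poly_Mapping.keys p"
  shows "monom_eval a m = (\<Prod>i\<in>Poly_Mapping.keys m. a i)"
proof -
  have "Poly_Mapping.lookup m i = 1" if "i \<in> Poly_Mapping.keys m" for i
  proof -
    have "Poly_Mapping.lookup m i \<noteq> 0" "Poly_Mapping.lookup m i \<le> 1"
      using that assms by (auto simp: reduced_def in_keys_iff)
    then show ?thesis by linarith
  qed
  then show ?thesis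
    by (simp add: monom_eval_def)
qed

lemma reduced_add: "reduced p \<Longrightarrow> reduced q \<Longrightarrow> reduced (p + q)"
  using keys_add[of p q] unfolding reduced_def by blast

lemma reduced_uminus: "reduced (- p) \<longleftrightarrow> reduced p"
  by (simp add: reduced_def)

lemma set_encode_less:
  assumes "S \<subseteq> {..<n}"
  shows "set_encode S < 2 ^ n"
proof -
  have "set_encode S \<le> (\<Sum>i\<in>{0..<n}. 2 ^ i)"
    unfolding set_encode_def
    by (rule sum_mono2) (use assms in \<open>simp_all add: atLeast0LessThan\<close>)
  then show ?thesis
    unfolding sum_power2 by (rule le_less_trans) simp
qed


section \<open>Uniqueness of the expansion\<close>

text \<open>
  A realisation of the relations below the top one in a polynomial ring in one variable. The index
  starts at \<open>0\<close> so that the degree of the image of \<open>x\<^sub>i\<close> is exactly its weight \<open>2\<^sup>i\<close>.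
\<close>

fun tower :: "nat \<Rightarrow> int poly" where
  "tower 0 = [:0, 1:]"
| "tower (Suc i) = tower i ^ 2 - 2 * tower i"

lemma tower_monic: "degree (tower i) = 2 ^ i \<and> lead_coeff (tower i) = 1"
proof (induction i)
  case (Suc i)
  have "tower i \<noteq> 0" using Suc by auto
  then have sq: "degree (tower i ^ 2) = 2 ^ Suc i" "lead_coeff (tower i ^ 2) = 1"
    using conjunct1[OF Suc] conjunct2[OF Suc]
    by (simp add: degree_power_eq, simp only: lead_coeff_power power_one)
  have "degree (2 * tower i) \<le> 2 ^ i"
    using Suc degree_mult_le[of 2 "tower i"] by simp
  then have less: "degree (- (2 * tower i)) < degree (tower i ^ 2)"
    unfolding sq by (simp add: le_less_trans)
  have "degree (tower (Suc i)) = 2 ^ Suc i"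
    using degree_add_eq_left[OF less] sq by simp
  moreover have "lead_coeff (tower (Suc i)) = 1"
    using lead_coeff_add_le[OF less] sq by simp
  ultimately show ?case by simp
qed simp

text \<open>
  Degrees add up over a product, so the degree of the image of a squarefree monomial is the number
  whose binary digits mark the variables that occur.
\<close>

lemma tower_prod_monic:
  assumes "finite S"
  shows "degree (\<Prod>i\<in>S. tower i) = set_encode S \<and> lead_coeff (\<Prod>i\<in>S. tower i) = 1"
proof -
  have "tower i \<noteq> 0" for i
    using tower_monic[of i] by auto
  then have "degree (\<Prod>i\<in>S. tower i) = set_encode S"
    using assms tower_monic by (simp add: degree_prod_eq_sum_degree set_encode_def)
  moreover have "lead_coeff (\<Prod>i\<in>S. tower i) = 1"
    unfolding lead_coeff_prod by (intro prod.neutral) (use tower_monic in blast)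
  ultimately show ?thesis by blast
qed

text \<open>
  Distinct reduced monomials have monic images of distinct degrees, so the term of largest degree
  cannot cancel.
\<close>

lemma reduced_degree_eval_tower:
  assumes "reduced p" "p \<in> carrier (poly_ring N)" "p \<noteq> 0"
  shows "ring_eval tower p \<noteq> 0 \<and> degree (ring_eval tower p) < 2 ^ (N + 1)"
proof -
  define w where "w m = set_encode (Poly_Mapping.keys m)" for m :: "nat \<Rightarrow>\<^sub>0 nat"
  let ?K = "Poly_Mapping.keys p"
  have ev: "degree (monom_eval tower m) = w m" "lead_coeff (monom_eval tower m) = 1"
    if "m \<in> ?K" for m
    using tower_prod_monic[OF finite_keys, of m]
    unfolding w_def reduced_monom_eval[OF assms(1) that] by blast+
  have inj: "inj_on w ?K"
  proof (rule inj_onI)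
    fix m m' assume m: "m \<in> ?K" "m' \<in> ?K" and "w m = w m'"
    then have "Poly_Mapping.keys m = Poly_Mapping.keys m'"
      by (simp add: w_def set_encode_eq)
    then show "m = m'"
      using reduced_monom_eq_set_monom[OF assms(1) m(1)] reduced_monom_eq_set_monom[OF assms(1) m(2)] by simp
  qed
  have K: "finite (w ` ?K)" "w ` ?K \<noteq> {}"
    using assms(3) by auto
  \<comment> \<open>Only the monomial of largest weight contributes to the coefficient in that degree.\<close>
  obtain m0 where m0: "m0 \<in> ?K" "w m0 = Max (w ` ?K)"
    using Max_in[OF K] by auto
  have le: "w m \<le> w m0" if "m \<in> ?K" for m
    using that m0 K by simp
  have bound: "w m < 2 ^ (N + 1)" if "m \<in> ?K" for m
  proof -
    have "Poly_Mapping.keys m \<subseteq> {1..N}"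
      using assms(2) that by (simp only: in_poly_ring_iff)
    also have "\<dots> \<subseteq> {..<N + 1}"
      by auto
    finally show ?thesis
      unfolding w_def by (rule set_encode_less)
  qed
  have "coeff (ring_eval tower p) (w m0) =
      (\<Sum>m\<in>?K. Poly_Mapping.lookup p m * coeff (monom_eval tower m) (w m0))"
    by (simp add: ring_eval_def coeff_sum of_int_poly)
  also have "\<dots> = (\<Sum>m\<in>?K. if m = m0 then Poly_Mapping.lookup p m0 else 0)"
  proof (rule sum.cong)
    fix m assume m: "m \<in> ?K"
    show "Poly_Mapping.lookup p m * coeff (monom_eval tower m) (w m0) =
        (if m = m0 then Poly_Mapping.lookup p m0 else 0)"
    proof (cases "m = m0")
      case False
      then have "w m \<noteq> w m0"
        using inj_on_eq_iff[OF inj m m0(1)] by simp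
      then have "w m < w m0"
        using le[OF m] by simp
      then show ?thesis
        using False ev(1)[OF m] by (simp add: coeff_eq_0)
    qed (use ev[OF m] in simp)
  qed simp
  also have "\<dots> = Poly_Mapping.lookup p m0"
    using m0 by simp
  also have "\<dots> \<noteq> 0"
    using m0 by (simp add: in_keys_iff)
  finally have "ring_eval tower p \<noteq> 0"
    by auto
  moreover have "degree (ring_eval tower p) \<le> w m0"
    unfolding ring_eval_def
  proof (rule degree_sum_le)
    fix m assume m: "m \<in> ?K"
    have "degree (of_int (Poly_Mapping.lookup p m) * monom_eval tower m) \<le>
        degree (monom_eval tower m)"
      by (simp add: of_int_poly)
    then show "degree (of_int (Poly_Mapping.lookup p m) * monom_eval tower m) \<le> w m0"
      using ev(1)[OF m] le[OF m] by simp
  qed simp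
  ultimately show ?thesis
    using bound[OF m0(1)] by simp
qed

text \<open>
  The image of a polynomial in the ideal is a multiple of the image of \<open>x\<^sub>N\<^sup>2\<close>, whose degree
  \<open>2\<^bsup>N+1\<^esup>\<close> is too large for the image of a nonzero reduced polynomial.
\<close>

lemma reduced_in_rel_ideal_eq_0:
  assumes "reduced p" "p \<in> carrier (poly_ring N)" "p \<in> rel_ideal N"
  shows "p = 0"
proof (rule ccontr)
  assume "p \<noteq> 0"
  then have nz: "ring_eval tower p \<noteq> 0" and deg: "degree (ring_eval tower p) < 2 ^ (N + 1)"
    using reduced_degree_eval_tower[OF assms(1,2)] by auto
  have "tower N ^ 2 dvd ring_eval tower (Var i ^ 2 - Prel N i)" if "i \<in> {1..N}" for i
  proof (cases "i < N")
    case True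
    have "2 * tower i + tower (i + 1) = tower i ^ 2"
      by simp
    then show ?thesis
      unfolding ring_eval_lower_relation[OF True] by (simp only: diff_self dvd_0_right)
  next
    case False
    then have "i = N"
      using that by simp
    then show ?thesis
      by (simp only: Prel_def less_irrefl if_False diff_zero ring_eval_power ring_eval_Var dvd_refl)
  qed
  then have "tower N ^ 2 dvd ring_eval tower p"
    by (intro dvd_ring_eval_genideal[OF generators_closed _ assms(3)[unfolded rel_ideal_def]])
       (elim imageE, simp only:)
  then have "degree (tower N ^ 2) \<le> degree (ring_eval tower p)"
    using nz by (rule dvd_imp_degree_le)
  moreover have "degree (tower N ^ 2) = 2 ^ (N + 1)"
  proof -
    have "tower N \<noteq> 0"
      using tower_monic[of N] by auto
    then show ?thesis
      using conjunct1[OF tower_monic[of N]] by (simp add: degree_power_eq)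
  qed
  ultimately show False
    using deg by simp
qed

lemma expansion_eqI:
  assumes "p \<in> carrier (poly_ring N)" "reduced p" "p - q \<in> rel_ideal N"
  shows "expansion N (rel_ideal N +>\<^bsub>poly_ring N\<^esub> q) = p"
  unfolding expansion_def mem_rcoset_iff
proof (rule the_equality)
  fix p' assume p': "p' \<in> carrier (poly_ring N) \<and> reduced p' \<and> p' - q \<in> rel_ideal N"
  then have "(p' - q) - (p - q) \<in> rel_ideal N"
    using assms(3) ideal_poly_ring_closed(4)[OF ideal_rel_ideal] by blast
  moreover have "reduced (p' - p)"
    using p' assms(2) reduced_add[of p' "- p"] by (simp add: reduced_uminus)
  ultimately have "p' - p = 0"
    using p' assms(1) by (intro reduced_in_rel_ideal_eq_0[of _ N]) auto
  then show "p' = p" by simp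
qed (use assms in simp)


section \<open>Reduction by the relations below the top variable\<close>

text \<open>
  The bound \<open>k\<close> on the weights in the reduced form is what guarantees, in the inductive proofs, that
  multiplication by a variable never has to square \<open>x\<^sub>N\<close>.
\<close>

definition reduces_below :: "nat \<Rightarrow> nat \<Rightarrow> int_mpoly \<Rightarrow> bool" where
  "reduces_below N k p \<longleftrightarrow> (\<exists>q \<in> carrier (poly_ring N). reduced q \<and>
    (\<forall>m\<in>Poly_Mapping.keys q. set_encode (Poly_Mapping.keys m) \<le> k) \<and> p - q \<in> lower_ideal N)"

lemma reduces_below_cong:
  assumes "reduces_below N k p'" "p - p' \<in> lower_ideal N"
  shows "reduces_below N k p"
proof -
  have "p - q \<in> lower_ideal N" if "p' - q \<in> lower_ideal N" for q
    using ideal_poly_ring_closed(2)[OF ideal_lower_ideal assms(2) that] by simp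
  then show ?thesis
    using assms(1) unfolding reduces_below_def by blast
qed

lemma reduces_below_mono: "reduces_below N k p \<Longrightarrow> k \<le> l \<Longrightarrow> reduces_below N l p"
  unfolding reduces_below_def by (meson order_trans)

lemma reduces_below_0: "reduces_below N k 0"
  unfolding reduces_below_def
  by (rule bexI[of _ 0]) (auto simp: reduced_def ideal_poly_ring_closed(1)[OF ideal_lower_ideal])

lemma reduces_below_add:
  assumes "reduces_below N k p" "reduces_below N k q"
  shows "reduces_below N k (p + q)"
proof -
  obtain p' q' where p': "p' \<in> carrier (poly_ring N)" "reduced p'"
      "\<forall>m\<in>Poly_Mapping.keys p'. set_encode (Poly_Mapping.keys m) \<le> k" "p - p' \<in> lower_ideal N"
    and q': "q' \<in> carrier (poly_ring N)" "reduced q'"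
      "\<forall>m\<in>Poly_Mapping.keys q'. set_encode (Poly_Mapping.keys m) \<le> k" "q - q' \<in> lower_ideal N"
    using assms unfolding reduces_below_def by blast
  show ?thesis
    unfolding reduces_below_def
  proof (intro bexI conjI)
    show "\<forall>m\<in>Poly_Mapping.keys (p' + q'). set_encode (Poly_Mapping.keys m) \<le> k"
      using p'(3) q'(3) keys_add[of p' q'] by blast
    show "p + q - (p' + q') \<in> lower_ideal N"
      using ideal_poly_ring_closed(2)[OF ideal_lower_ideal p'(4) q'(4)] by (simp add: algebra_simps)
  qed (use p' q' in \<open>auto intro: reduced_add\<close>)
qed

lemma reduces_below_sum:
  "(\<And>i. i \<in> I \<Longrightarrow> reduces_below N k (f i)) \<Longrightarrow> reduces_below N k (\<Sum>i\<in>I. f i)"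
  by (induction I rule: infinite_finite_induct)
     (auto intro: reduces_below_add reduces_below_0)

lemma reduces_below_const_mult:
  assumes "reduces_below N k p"
  shows "reduces_below N k (Poly_Mapping.single 0 c * p)"
proof -
  let ?c = "Poly_Mapping.single 0 c :: int_mpoly"
  obtain q where q: "q \<in> carrier (poly_ring N)" "reduced q"
      "\<forall>m\<in>Poly_Mapping.keys q. set_encode (Poly_Mapping.keys m) \<le> k" "p - q \<in> lower_ideal N"
    using assms unfolding reduces_below_def by blast
  have c: "?c \<in> carrier (poly_ring N)"
    by (simp add: in_poly_ring_iff)
  have keys: "Poly_Mapping.keys (?c * q) \<subseteq> Poly_Mapping.keys q"
    using keys_mult[of ?c q] by (auto split: if_splits)
  show ?thesis
    unfolding reduces_below_def
  proof (intro bexI conjI)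
    show "reduced (?c * q)"
      using q(2) keys unfolding reduced_def by blast
    show "\<forall>m\<in>Poly_Mapping.keys (?c * q). set_encode (Poly_Mapping.keys m) \<le> k"
      using q(3) keys by blast
    show "?c * p - ?c * q \<in> lower_ideal N"
      using ideal_poly_ring_closed(3)[OF ideal_lower_ideal q(4) c] by (simp add: algebra_simps)
  qed (use c q in auto)
qed

lemma reduces_below_sqfree:
  assumes "finite S" "S \<subseteq> {1..N}" "set_encode S \<le> k"
  shows "reduces_below N k (sqfree S)"
  unfolding reduces_below_def
  by (rule bexI[of _ "sqfree S"])
     (use assms in \<open>auto simp: sqfree_eq_single keys_set_monom reduced_def lookup_set_monom in_poly_ring_iff
        ideal_poly_ring_closed(1)[OF ideal_lower_ideal]\<close>)

text \<open>
  This is binary addition of \<open>2\<^sup>j\<close> to the weight of the monomial. If the digit \<open>j\<close> is unset, the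
  product is already reduced. If it is set, the relation replaces \<open>x\<^sub>j\<^sup>2\<close> by \<open>2 x\<^sub>j\<close>, of smaller
  weight, plus \<open>x\<^bsub>j+1\<^esub>\<close>, which carries to the next digit. The bound on the weight rules out a carry
  beyond the digit \<open>N\<close>.
\<close>

lemma reduces_below_Var_mult_sqfree:
  assumes "finite S" "S \<subseteq> {1..N}" "j \<in> {1..N}" "set_encode S + 2 ^ j < 2 ^ (N + 1)"
  shows "reduces_below N (set_encode S + 2 ^ j) (Var j * sqfree S)"
  using assms
proof (induction "N - j" arbitrary: j S)
  case (0 j S)
  then have "j = N" by simp
  have "j \<notin> S"
  proof
    assume "j \<in> S"
    then have "(2::nat) ^ j \<le> set_encode S"
      unfolding set_encode_def using 0 by (intro member_le_sum) auto
    then show False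
      using 0 \<open>j = N\<close> by simp
  qed
  then have "Var j * sqfree S = sqfree (insert j S)"
    using 0 by (simp add: sqfree_def)
  then show ?case
    using 0 \<open>j \<notin> S\<close> by (auto intro!: reduces_below_sqfree)
next
  case (Suc d j S)
  show ?case
  proof (cases "j \<in> S")
    case False
    then have "Var j * sqfree S = sqfree (insert j S)"
      using Suc.prems by (simp add: sqfree_def)
    then show ?thesis
      using Suc.prems False by (auto intro!: reduces_below_sqfree)
  next
    case True
    define T where "T = S - {j}"
    have S: "S = insert j T" "j \<notin> T" "finite T" "T \<subseteq> {1..N}"
      using True Suc.prems by (auto simp: T_def)
    have j: "j \<in> {1..<N}"
      using Suc.hyps(2) Suc.prems(3) by simp
    \<comment> \<open>The carry preserves the weight.\<close>
    have enc: "set_encode S + 2 ^ j = set_encode T + 2 ^ (j + 1)"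
      using S by simp
    have sqS: "sqfree S = Var j * sqfree T"
      using S by (simp add: sqfree_def)
    have "reduces_below N (set_encode T + 2 ^ (j + 1)) (Var (j + 1) * sqfree T)"
      using Suc.hyps S j Suc.prems(4) enc by (intro Suc.hyps(1)) auto
    moreover have "reduces_below N (set_encode T + 2 ^ (j + 1)) (sqfree S)"
      by (rule reduces_below_sqfree) (use Suc.prems enc in auto)
    ultimately have "reduces_below N (set_encode S + 2 ^ j)
        ((sqfree S + sqfree S) + Var (j + 1) * sqfree T)"
      unfolding enc by (intro reduces_below_add)
    moreover have "Var j * sqfree S - ((sqfree S + sqfree S) + Var (j + 1) * sqfree T) \<in> lower_ideal N"
    proof -
      have "sqfree T \<in> carrier (poly_ring N)"
        using S by (simp add: sqfree_eq_single in_poly_ring_iff keys_set_monom)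
      then have "sqfree T * (Var j ^ 2 - (2 * Var j + Var (j + 1))) \<in> lower_ideal N"
        using ideal_poly_ring_closed(3)[OF ideal_lower_ideal lower_relation[OF j]] by blast
      then show ?thesis
        unfolding sqS by (simp add: algebra_simps power2_eq_square)
    qed
    ultimately show ?thesis
      by (rule reduces_below_cong)
  qed
qed

lemma reduces_below_Var_mult:
  assumes "reduces_below N k p" "j \<in> {1..N}" "k + 2 ^ j < 2 ^ (N + 1)"
  shows "reduces_below N (k + 2 ^ j) (Var j * p)"
proof -
  obtain q where q: "q \<in> carrier (poly_ring N)" "reduced q"
      "\<forall>m\<in>Poly_Mapping.keys q. set_encode (Poly_Mapping.keys m) \<le> k" "p - q \<in> lower_ideal N"
    using assms(1) unfolding reduces_below_def by blast
  have "Var j * q = (\<Sum>m\<in>Poly_Mapping.keys q. Poly_Mapping.single 0 (Poly_Mapping.lookup q m) *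
      (Var j * sqfree (Poly_Mapping.keys m)))"
  proof -
    have "Poly_Mapping.single m (Poly_Mapping.lookup q m) =
        Poly_Mapping.single 0 (Poly_Mapping.lookup q m) * sqfree (Poly_Mapping.keys m)"
      if "m \<in> Poly_Mapping.keys q" for m
      using reduced_monom_eq_set_monom[OF q(2) that] by (simp add: sqfree_eq_single mult_single)
    then have "q = (\<Sum>m\<in>Poly_Mapping.keys q.
        Poly_Mapping.single 0 (Poly_Mapping.lookup q m) * sqfree (Poly_Mapping.keys m))"
      using sum_of_terms[of q] by simp
    from arg_cong[OF this, of "(*) (Var j)"] show ?thesis
      unfolding sum_distrib_left by (simp add: mult_ac)
  qed
  moreover have "reduces_below N (k + 2 ^ j) (Var j * sqfree (Poly_Mapping.keys m))"
    if "m \<in> Poly_Mapping.keys q" for m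
  proof (rule reduces_below_mono[OF reduces_below_Var_mult_sqfree])
    have le: "set_encode (Poly_Mapping.keys m) \<le> k"
      using q(3) that by blast
    then show "set_encode (Poly_Mapping.keys m) + 2 ^ j < 2 ^ (N + 1)"
      "set_encode (Poly_Mapping.keys m) + 2 ^ j \<le> k + 2 ^ j"
      using assms(3) by simp_all
  qed (use q(1) that assms in \<open>auto simp: in_poly_ring_iff\<close>)
  ultimately have "reduces_below N (k + 2 ^ j) (Var j * q)"
    by (auto intro!: reduces_below_sum reduces_below_const_mult)
  moreover have "Var j * p - Var j * q \<in> lower_ideal N"
    using ideal_poly_ring_closed(3)[OF ideal_lower_ideal q(4) Var_closed[OF assms(2)]]
    by (simp add: algebra_simps)
  ultimately show ?thesis
    by (rule reduces_below_cong)
qed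

lemma reduces_below_power:
  assumes "N \<ge> 1" "n < 2 ^ N"
  shows "reduces_below N (2 * n) ((1 + Var 1) ^ n)"
  using assms(2)
proof (induction n)
  case 0
  show ?case
    using reduces_below_sqfree[of "{}" N 0] by (simp add: sqfree_def)
next
  case (Suc n)
  then have IH: "reduces_below N (2 * n) ((1 + Var 1) ^ n)"
    by simp
  have "reduces_below N (2 * n + 2 ^ 1) (Var 1 * (1 + Var 1) ^ n)"
    by (rule reduces_below_Var_mult[OF IH]) (use assms(1) Suc.prems in auto)
  moreover have "reduces_below N (2 * n + 2 ^ 1) ((1 + Var 1) ^ n)"
    by (rule reduces_below_mono[OF IH]) simp
  ultimately show ?case
    using reduces_below_add by (fastforce simp: distrib_right)
qed


section \<open>Constant terms of Laurent polynomials\<close>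

definition trinomial :: "nat \<Rightarrow> int fls" where
  "trinomial i = 1 + fls_X_intpow (2 ^ i) + fls_X_intpow (- (2 ^ i))"

text \<open>
  The doubling rule \<open>(z\<^sup>d + z\<^sup>-\<^sup>d)\<^sup>2 = z\<^sup>2\<^sup>d + z\<^sup>-\<^sup>2\<^sup>d + 2\<close>, shifted by \<open>1\<close>.
\<close>

lemma trinomial_square: "trinomial i ^ 2 = 2 * trinomial i + trinomial (i + 1)"
proof -
  let ?z = "fls_X_intpow (2 ^ i) :: int fls" and ?w = "fls_X_intpow (- (2 ^ i)) :: int fls"
  have square: "(1 + z + w) ^ 2 = 2 * (1 + z + w) + (1 + z * z + w * w)" if "z * w = 1"
    for z w :: "int fls"
  proof -
    have "(1 + z + w) ^ 2 = 1 + z * z + w * w + 2 * z + 2 * w + 2 * (z * w)"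
      by (simp add: power2_eq_square algebra_simps)
    then show ?thesis
      using that by (simp add: algebra_simps)
  qed
  have "?z * ?w = 1" "?z * ?z = fls_X_intpow (2 ^ (i + 1))" "?w * ?w = fls_X_intpow (- (2 ^ (i + 1)))"
    unfolding fls_X_intpow_times_fls_X_intpow by simp_all
  then show ?thesis
    using square[of ?z ?w] unfolding trinomial_def by (simp only:)
qed

lemma trinomial_mult_nth:
  "fls_nth (trinomial i * f) k = fls_nth f k + fls_nth f (k - 2 ^ i) + fls_nth f (k + 2 ^ i)"
  unfolding trinomial_def distrib_right fls_X_intpow_times_conv_shift by simp

text \<open>
  The factor with the largest index \<open>b\<close> shifts exponents by \<open>0\<close> or \<open>\<plusminus>2\<^sup>b\<close>, whereas the exponents in
  the product of the others are smaller than \<open>2\<^sup>b\<close> in absolute value. So only the shift by \<open>0\<close>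
  reaches the constant term. The bound on the exponents is carried along for the induction.
\<close>

lemma trinomial_prod_nth:
  assumes "finite S"
  shows "fls_nth (\<Prod>i\<in>S. trinomial i) 0 = 1 \<and>
    (\<forall>k. \<bar>k\<bar> > int (set_encode S) \<longrightarrow> fls_nth (\<Prod>i\<in>S. trinomial i) k = 0)"
  using assms
proof (induction S rule: finite_linorder_max_induct)
  case (insert b S)
  let ?f = "\<Prod>i\<in>S. trinomial i"
  have b: "b \<notin> S"
    using insert.hyps by auto
  have "set_encode S < 2 ^ b"
    using insert.hyps by (intro set_encode_less) auto
  then have "int (set_encode S) < int (2 ^ b)"
    by (simp only: of_nat_less_iff)
  then have less: "int (set_encode S) < 2 ^ b"
    by simp
  have prod: "fls_nth (\<Prod>i\<in>insert b S. trinomial i) k =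
      fls_nth ?f k + fls_nth ?f (k - 2 ^ b) + fls_nth ?f (k + 2 ^ b)" for k
    using insert.hyps(1) b by (simp add: trinomial_mult_nth)
  show ?case
  proof (intro conjI allI impI)
    show "fls_nth (\<Prod>i\<in>insert b S. trinomial i) 0 = 1"
      unfolding prod using insert.IH less by simp
  next
    fix k assume "\<bar>k\<bar> > int (set_encode (insert b S))"
    then have "\<bar>k\<bar> > 2 ^ b + int (set_encode S)"
      using insert.hyps(1) b by simp
    moreover have "(0::int) < 2 ^ b"
      by simp
    ultimately have "\<bar>k\<bar> > int (set_encode S)" "\<bar>k - 2 ^ b\<bar> > int (set_encode S)"
      "\<bar>k + 2 ^ b\<bar> > int (set_encode S)"
      by linarith+
    then show "fls_nth (\<Prod>i\<in>insert b S. trinomial i) k = 0"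
      unfolding prod using insert.IH by simp
  qed
qed simp

text \<open>
  Because \<open>1 + (1 + z\<^sup>2 + z\<^sup>-\<^sup>2) = z\<^sup>-\<^sup>2 (1 + z\<^sup>2)\<^sup>2\<close>, this is a coefficient of the binomial theorem.
\<close>

lemma one_plus_trinomial_power_nth:
  "fls_nth ((1 + trinomial 1) ^ n) 0 = int ((2 * n) choose n)"
proof -
  let ?z = "fls_X_intpow 2 :: int fls" and ?w = "fls_X_intpow (- 2) :: int fls"
  have "?w * ?z = 1"
    using fls_X_intpow_times_fls_X_intpow[of "- 2" 2, where ?'a = int] by simp
  moreover have "1 + (1 + z + w) = w * (z + 1) ^ 2" if "w * z = 1" for z w :: "int fls"
  proof -
    have "w * (z + 1) ^ 2 = (w * z) * z + 2 * (w * z) + w"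
      by (simp add: power2_eq_square algebra_simps)
    then show ?thesis
      using that by simp
  qed
  ultimately have "1 + trinomial 1 = ?w * (?z + 1) ^ 2"
    unfolding trinomial_def power_one_right by blast
  then have "(1 + trinomial 1) ^ n = ?w ^ n * (?z + 1) ^ (2 * n)"
    by (simp only: power_mult_distrib power_mult)
  also have "?w ^ n = fls_X_intpow (- (2 * int n))"
    by (subst fls_X_intpow_power) (simp add: mult.commute)
  finally have "fls_nth ((1 + trinomial 1) ^ n) 0 = fls_nth ((?z + 1) ^ (2 * n)) (2 * int n)"
    by (simp only: fls_X_intpow_times_conv_shift fls_shift_nth) simp
  also have "(?z + 1) ^ (2 * n) =
      (\<Sum>k\<le>2 * n. of_nat ((2 * n) choose k) * fls_X_intpow (int k * 2))"
    unfolding binomial_ring fls_X_intpow_power by simp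
  also have "fls_nth \<dots> (2 * int n) = (\<Sum>k\<le>2 * n. if k = n then int ((2 * n) choose k) else 0)"
    unfolding fls_nth_sum
    by (intro sum.cong refl) (simp add: fls_X_intpow_times_conv_shift fls_of_nat_nth)
  also have "\<dots> = int ((2 * n) choose n)"
    by simp
  finally show ?thesis .
qed

lemma constant_term_eval_trinomial:
  assumes "reduced p"
  shows "fls_nth (ring_eval trinomial p) 0 = mpoly_eval (\<lambda>_. 1) p"
proof -
  have "fls_nth (of_int c * f) 0 = c * fls_nth f 0" for c and f :: "int fls"
    by (simp add: fls_of_int)
  moreover have "fls_nth (monom_eval trinomial m) 0 = 1" if "m \<in> Poly_Mapping.keys p" for m
    using trinomial_prod_nth[of "Poly_Mapping.keys m"] reduced_monom_eval[OF assms that, of trinomial] by simp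
  ultimately show ?thesis
    by (simp add: ring_eval_def mpoly_eval_def fls_nth_sum)
qed

lemma eval_trinomial_lower_ideal:
  assumes "p \<in> lower_ideal N"
  shows "ring_eval trinomial p = 0"
proof -
  have "0 dvd ring_eval trinomial p"
  proof (rule dvd_ring_eval_genideal[OF _ _ assms[unfolded lower_ideal_def]])
    show "(\<lambda>i. Var i ^ 2 - Prel N i) ` {1..<N} \<subseteq> carrier (poly_ring N)"
      using generators_closed[of N] by fastforce
  next
    fix g assume "g \<in> (\<lambda>i. Var i ^ 2 - Prel N i) ` {1..<N}"
    then obtain i where "i < N" "g = Var i ^ 2 - Prel N i"
      by auto
    then show "0 dvd ring_eval trinomial g"
      by (simp only: ring_eval_lower_relation trinomial_square diff_self dvd_refl)
  qed
  then show ?thesis by simp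
qed


section \<open>The central binomial coefficient\<close>

lemma KN_power_eq_rcoset:
  assumes "N \<ge> 1"
  shows "(\<one>\<^bsub>KN N\<^esub> \<oplus>\<^bsub>KN N\<^esub> gen N 1) [^]\<^bsub>KN N\<^esub> n =
    rel_ideal N +>\<^bsub>poly_ring N\<^esub> (1 + Var 1) ^ n"
proof -
  interpret h: ring_hom_ring "poly_ring N" "KN N" "(+>\<^bsub>poly_ring N\<^esub>) (rel_ideal N)"
    unfolding KN_def by (rule ideal.rcos_ring_hom_ring[OF ideal_rel_ideal])
  have V: "Var 1 \<in> carrier (poly_ring N)"
    using assms by auto
  then have "rel_ideal N +>\<^bsub>poly_ring N\<^esub> (1 + Var 1) = \<one>\<^bsub>KN N\<^esub> \<oplus>\<^bsub>KN N\<^esub> gen N 1"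
    using h.hom_add[of 1 "Var 1"] h.hom_one poly_ring_closed(2) by (simp add: gen_def)
  moreover have "1 + Var 1 \<in> carrier (poly_ring N)"
    using V by auto
  ultimately show ?thesis
    using h.hom_nat_pow[of "1 + Var 1" n] by (simp add: poly_ring_nat_pow)
qed

text \<open>
  A reduced form of \<open>(1 + x\<^sub>1)\<^sup>n\<close> obtained without the top relation is the expansion by uniqueness,
  and has the same image in the Laurent model as \<open>(1 + x\<^sub>1)\<^sup>n\<close>. Comparing constant terms gives the
  value.
\<close>

lemma eval_expansion_power:
  assumes "N \<ge> 1" "n < 2 ^ N"
  shows "mpoly_eval (\<lambda>_. 1) (expansion N ((\<one>\<^bsub>KN N\<^esub> \<oplus>\<^bsub>KN N\<^esub> gen N 1) [^]\<^bsub>KN N\<^esub> n))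
    = int ((2 * n) choose n)"
proof -
  obtain q where q: "q \<in> carrier (poly_ring N)" "reduced q" "(1 + Var 1) ^ n - q \<in> lower_ideal N"
    using reduces_below_power[OF assms] unfolding reduces_below_def by blast
  have "q - (1 + Var 1) ^ n \<in> rel_ideal N"
    using ideal_poly_ring_closed(4)[OF ideal_rel_ideal, of 0 N "(1 + Var 1) ^ n - q"]
      ideal_poly_ring_closed(1)[OF ideal_rel_ideal] lower_ideal_subset q(3) by auto
  then have "expansion N ((\<one>\<^bsub>KN N\<^esub> \<oplus>\<^bsub>KN N\<^esub> gen N 1) [^]\<^bsub>KN N\<^esub> n) = q"
    unfolding KN_power_eq_rcoset[OF assms(1)] using q by (intro expansion_eqI)
  moreover have "ring_eval trinomial q = (1 + trinomial 1) ^ n"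
    using eval_trinomial_lower_ideal[OF q(3)]
    by (simp add: ring_eval_diff ring_eval_power ring_eval_add)
  ultimately show ?thesis
    using constant_term_eval_trinomial[OF q(2)] one_plus_trinomial_power_nth[of n] by simp
qed

theorem theorem5:
  fixes n b :: nat
  assumes "n \<ge> 1"
    and "int b = \<lfloor>log 2 (real n)\<rfloor> + 2"
  shows "mpoly_eval (\<lambda>_. 1)
           (expansion b ((\<one>\<^bsub>KN b\<^esub> \<oplus>\<^bsub>KN b\<^esub> gen b 1) [^]\<^bsub>KN b\<^esub> n))
         = int ((2 * n) choose n)"
proof (rule eval_expansion_power)
  have "0 \<le> log 2 (real n)"
    using assms(1) by simp
  then show "b \<ge> 1"
    using assms(2) by linarith
  have "log 2 (real n) < real b"
    using assms(2) by linarith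
  then have "real n < 2 powr real b"
    using assms(1) by (simp add: log_less_iff)
  also have "\<dots> = real (2 ^ b)"
    by (simp add: powr_realpow)
  finally show "n < 2 ^ b"
    by (simp only: of_nat_less_iff)
qed

end
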